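(* Let $p>5$ be a prime. If $\left(\frac p{15}\right)=1$, i.e., $p\equiv 1,2,4,8\pmod{15}$, then $$\sum_{k=0}^{p-1}\frac{u_k(1,4)}{2^k}H_k\equiv 0\pmod p.$$ If $\left(\frac p{15}\right)=-1$, i.e., $p\equiv 7,11,13,14\pmod{15}$, then $$\sum_{k=0}^{p-1}\frac{u_{k+1}(1,4)}{2^k}H_k\equiv 0\pmod p.$$
   Context: For $n\in\{0,1,2,\ldots\}$, the harmonic number is $H_n=\sum_{0<j\le n}1/j$ (so $H_0=0$). The Lucas sequence $u_n=u_n(1,4)$ ($n\ge0$) is defined by $u_0=0$, $u_1=1$, $u_{n+1}=u_n-4u_{n-1}$ for $n\ge1$. The symbol $\left(\frac{\cdot}{15}\right)$ is the Jacobi symbol. A congruence $x\equiv y\pmod{p}$ between rational numbers means that $x-y\in p\,\mathbb{Z}_{(p)}$, where $\mathbb{Z}_{(p)}$ is the ring of rational numbers whose denominator (in lowest terms) is prime to $p$. *)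

theory Defs
  imports "HOL-Analysis.Harmonic_Numbers" "HOL-Number_Theory.Number_Theory"
begin

text \<open>
  The library's \<open>harm\<close> lives in a real normed field, which excludes type \<open>rat\<close>. The congruences
  below concern rational numbers, so the harmonic numbers are taken there.
\<close>

definition harmonic :: "nat \<Rightarrow> rat" where
  "harmonic n = (\<Sum>j\<in>{0<..n}. 1 / of_nat j)"

lemma of_rat_harmonic: "of_rat (harmonic n) = (harm n :: real)"
proof -
  have "{0<..n} = {1..n}" by auto
  then show ?thesis
    by (simp add: harmonic_def harm_def of_rat_sum of_rat_divide inverse_eq_divide)
qed

fun lucas_u :: "int \<Rightarrow> int \<Rightarrow> nat \<Rightarrow> int" where
  "lucas_u A B 0 = 0"
| "lucas_u A B (Suc 0) = 1"
| "lucas_u A B (Suc (Suc n)) = A * lucas_u A B (Suc n) - B * lucas_u A B n"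

text \<open>
  The product ranges over the prime factors of \<open>n\<close> with multiplicity. It is the Jacobi symbol
  only for odd positive \<open>n\<close>.
\<close>

definition jacobi :: "int \<Rightarrow> nat \<Rightarrow> int" where
  "jacobi a n = (\<Prod>q\<in>#prime_factorization n. Legendre a (int q))"

text \<open>The ring \<open>\<int>\<^sub>(\<^sub>p\<^sub>)\<close>; \<open>quotient_of\<close> yields numerator and denominator in lowest terms.\<close>

definition Z_loc :: "nat \<Rightarrow> rat set" where
  "Z_loc p = {x. coprime (snd (quotient_of x)) (int p)}"

definition rat_cong :: "rat \<Rightarrow> rat \<Rightarrow> nat \<Rightarrow> bool" where
  "rat_cong x y p \<longleftrightarrow> x - y \<in> (\<lambda>z. of_nat p * z) ` Z_loc p"

end

theory Submission
  imports Defs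
begin

text \<open>
  Put \<open>U\<^sub>k = u\<^sub>k / 2\<^sup>k\<close>. Dividing the Lucas recurrence by the powers of \<open>2\<close> gives
  \<open>U\<^sub>k\<^sub>+\<^sub>2 = U\<^sub>k\<^sub>+\<^sub>1 / 2 - U\<^sub>k\<close>, a recurrence that reads the same in both directions.
  This reversibility is the reason for the weight \<open>2\<^sup>-\<^sup>k\<close>: the roots of the characteristic
  polynomial become \<open>w\<close> and \<open>1/w\<close>, and \<open>U\<^sub>k\<close> is a multiple of \<open>w\<^sup>k - w\<^sup>-\<^sup>k\<close>, an odd function of \<open>k\<close>.

  Both sums are killed by the reflection \<open>k \<mapsto> p - 1 - k\<close>. Modulo \<open>p\<close> the harmonic numbers satisfy
  \<open>H\<^bsub>p-1-k\<^esub> \<equiv> H\<^sub>k\<close>, because \<open>1/(p - j) \<equiv> -1/j\<close> and \<open>H\<^bsub>p-1\<^esub> \<equiv> 0\<close>. So a sum of \<open>f\<^sub>k H\<^sub>k\<close> vanishes as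
  soon as \<open>f\<^bsub>p-1-k\<^esub> \<equiv> -f\<^sub>k\<close> (\<open>antisymmetric_harmonic_sum\<close>). For a solution of a reversible
  recurrence this antisymmetry only has to be checked at one end (\<open>palindromic_recurrence_reflection\<close>).

  The discriminant is \<open>1 - 4 * 4 = -15\<close>. Let \<open>\<epsilon>\<close> be the quadratic character of \<open>-15\<close> modulo \<open>p\<close>.
  In \<open>GF(p)\<close> or its quadratic extension \<open>w\<^sup>p = w\<^sup>\<epsilon>\<close>, by Frobenius; below this takes the form of the congruences
  \<open>u\<^sub>p \<equiv> \<epsilon>\<close> and \<open>2 u\<^sub>p\<^sub>+\<^sub>1 \<equiv> 1 + \<epsilon>\<close>, read off from a binomial formula for \<open>u\<^sub>n\<close>
  (\<open>lucas_u_prime_cong\<close>). If \<open>\<epsilon> = 1\<close>, then \<open>U\<close> has period \<open>p - 1\<close>, so \<open>U\<^bsub>p-1-k\<^esub> \<equiv> -U\<^sub>k\<close>; if \<open>\<epsilon> = -1\<close>,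
  it has period \<open>p + 1\<close>, so \<open>U\<^bsub>p-k\<^esub> \<equiv> -U\<^sub>k\<^sub>+\<^sub>1\<close>, which is why the second sum is shifted. Quadratic
  reciprocity identifies \<open>\<epsilon>\<close> with the Jacobi symbol of \<open>p\<close> modulo \<open>15\<close>.
\<close>

section \<open>Congruences between rational numbers\<close>

lemma Z_loc_iff:
  assumes "prime p"
  shows "x \<in> Z_loc p \<longleftrightarrow> (\<exists>a b. coprime b (int p) \<and> x = of_int a / of_int b)"
proof
  assume "x \<in> Z_loc p"
  then have "coprime (snd (quotient_of x)) (int p)"
    by (simp add: Z_loc_def)
  moreover have "x = of_int (fst (quotient_of x)) / of_int (snd (quotient_of x))"
    by (rule quotient_of_div) simp
  ultimately show "\<exists>a b. coprime b (int p) \<and> x = of_int a / of_int b"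
    by blast
next
  assume "\<exists>a b. coprime b (int p) \<and> x = of_int a / of_int b"
  then obtain a b where b: "coprime b (int p)" and x: "x = of_int a / of_int b"
    by blast
  obtain n d where q: "quotient_of x = (n, d)"
    by (cases "quotient_of x")
  have d: "d > 0" "coprime n d" "x = of_int n / of_int d"
    using quotient_of_denom_pos[OF q] quotient_of_coprime[OF q] quotient_of_div[OF q] by auto
  have "b \<noteq> 0"
    using b prime_gt_1_nat[OF assms] by auto
  then have "of_int (n * b) = (of_int (a * d) :: rat)"
    using x d by (simp add: field_simps)
  then have "n * b = a * d"
    by (simp only: of_int_eq_iff)
  then have "d dvd n * b"
    by simp
  then have "d dvd b"
    using d(2) by (simp add: coprime_commute coprime_dvd_mult_right_iff)
  then have "coprime d (int p)"
    by (rule coprime_divisors[OF _ dvd_refl b])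
  then show "x \<in> Z_loc p"
    by (simp add: Z_loc_def q)
qed

lemma Z_loc_fraction:
  "prime p \<Longrightarrow> coprime b (int p) \<Longrightarrow> of_int a / of_int b \<in> Z_loc p"
  using Z_loc_iff by blast

lemma Z_loc_of_int: "prime p \<Longrightarrow> of_int a \<in> Z_loc p"
  using Z_loc_fraction[of p 1 a] by simp

lemma Z_loc_add:
  assumes "prime p" "x \<in> Z_loc p" "y \<in> Z_loc p"
  shows "x + y \<in> Z_loc p"
proof -
  obtain a b c d where "coprime b (int p)" "x = of_int a / of_int b"
      "coprime d (int p)" "y = of_int c / of_int d"
    using assms Z_loc_iff by metis
  moreover from this have "b \<noteq> 0" "d \<noteq> 0"
    using prime_gt_1_nat[OF assms(1)] by auto
  ultimately have "x + y = of_int (a * d + c * b) / of_int (b * d)" "coprime (b * d) (int p)"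
    by (auto simp: field_simps)
  then show ?thesis
    using Z_loc_fraction[OF assms(1)] by metis
qed

lemma Z_loc_mult:
  assumes "prime p" "x \<in> Z_loc p" "y \<in> Z_loc p"
  shows "x * y \<in> Z_loc p"
proof -
  obtain a b c d where "coprime b (int p)" "x = of_int a / of_int b"
      "coprime d (int p)" "y = of_int c / of_int d"
    using assms Z_loc_iff by metis
  then have "x * y = of_int (a * c) / of_int (b * d)" "coprime (b * d) (int p)"
    by auto
  then show ?thesis
    using Z_loc_fraction[OF assms(1)] by metis
qed

lemma Z_loc_sum:
  "prime p \<Longrightarrow> (\<And>i. i \<in> A \<Longrightarrow> f i \<in> Z_loc p) \<Longrightarrow> (\<Sum>i\<in>A. f i) \<in> Z_loc p"
  by (induction A rule: infinite_finite_induct) (auto intro: Z_loc_add Z_loc_of_int[of p 0, simplified])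

lemma Z_loc_inverse_of_nat:
  assumes "prime p" "0 < j" "j < p"
  shows "1 / of_nat j \<in> Z_loc p"
proof -
  have "\<not> p dvd j"
    using assms by (auto dest: dvd_imp_le)
  then have "coprime (int j) (int p)"
    using prime_imp_coprime[OF assms(1)] by (simp add: coprime_commute)
  then show ?thesis
    using Z_loc_fraction[of p "int j" 1] assms by simp
qed

lemma rat_cong_refl: "prime p \<Longrightarrow> rat_cong x x p"
  using Z_loc_of_int[of p 0] by (auto simp: rat_cong_def intro!: image_eqI[where x = 0])

lemma rat_cong_add:
  assumes "prime p" "rat_cong x y p" "rat_cong x' y' p"
  shows "rat_cong (x + x') (y + y') p"
proof -
  obtain z z' where "z \<in> Z_loc p" "x - y = of_nat p * z" "z' \<in> Z_loc p" "x' - y' = of_nat p * z'"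
    using assms unfolding rat_cong_def by blast
  then show ?thesis
    unfolding rat_cong_def using assms(1)
    by (auto intro!: image_eqI[where x = "z + z'"] Z_loc_add simp: algebra_simps)
qed

lemma rat_cong_mult_left:
  assumes "prime p" "c \<in> Z_loc p" "rat_cong x y p"
  shows "rat_cong (c * x) (c * y) p"
proof -
  obtain z where "z \<in> Z_loc p" "x - y = of_nat p * z"
    using assms unfolding rat_cong_def by blast
  then show ?thesis
    unfolding rat_cong_def using assms
    by (intro image_eqI[where x = "c * z"] Z_loc_mult)
       (auto simp: right_diff_distrib[symmetric] algebra_simps)
qed

lemma rat_cong_diff:
  assumes "prime p" "rat_cong x y p" "rat_cong x' y' p"
  shows "rat_cong (x - x') (y - y') p"
  using rat_cong_add[OF assms(1,2) rat_cong_mult_left[OF assms(1) _ assms(3), of "-1"]]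
    Z_loc_of_int[OF assms(1), of "-1"] by simp

lemma rat_cong_trans:
  "prime p \<Longrightarrow> rat_cong x y p \<Longrightarrow> rat_cong y z p \<Longrightarrow> rat_cong x z p"
  using rat_cong_add[of p x y y z] by (simp add: rat_cong_def)

lemma rat_cong_mult:
  assumes "prime p" "x \<in> Z_loc p" "y' \<in> Z_loc p" "rat_cong x y p" "rat_cong x' y' p"
  shows "rat_cong (x * x') (y * y') p"
  using rat_cong_trans[OF assms(1) rat_cong_mult_left[OF assms(1,2,5)]]
    rat_cong_mult_left[OF assms(1,3,4)] by (simp add: mult.commute)

lemma rat_cong_sum:
  "prime p \<Longrightarrow> (\<And>i. i \<in> A \<Longrightarrow> rat_cong (f i) (g i) p) \<Longrightarrow>
    rat_cong (\<Sum>i\<in>A. f i) (\<Sum>i\<in>A. g i) p"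
  by (induction A rule: infinite_finite_induct) (auto intro: rat_cong_add rat_cong_refl)

lemma rat_cong_fraction:
  assumes "prime p" "coprime b (int p)" "int p dvd a" "x - y = of_int a / of_int b"
  shows "rat_cong x y p"
proof -
  obtain c where "a = int p * c"
    using assms(3) by blast
  then show ?thesis
    unfolding rat_cong_def using assms Z_loc_fraction[OF assms(1,2), of c]
    by (intro image_eqI[where x = "of_int c / of_int b"]) auto
qed

lemma rat_cong_uminus_self:
  assumes "prime p" "p > 2" "rat_cong x (- x) p"
  shows "rat_cong x 0 p"
proof -
  have "rat_cong (1 / 2 * (x + x)) (1 / 2 * (- x + x)) p"
    using assms Z_loc_inverse_of_nat[of p 2]
    by (intro rat_cong_mult_left rat_cong_add rat_cong_refl) auto
  then show ?thesis
    by simp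
qed

section \<open>Reflection of harmonic numbers and of reversible recurrences\<close>

lemma harmonic_Suc: "harmonic (Suc n) = harmonic n + 1 / of_nat (Suc n)"
proof -
  have "{0<..Suc n} = insert (Suc n) {0<..n}"
    by auto
  then show ?thesis
    by (simp add: harmonic_def)
qed

lemma harmonic_in_Z_loc: "prime p \<Longrightarrow> n < p \<Longrightarrow> harmonic n \<in> Z_loc p"
  unfolding harmonic_def by (intro Z_loc_sum Z_loc_inverse_of_nat) auto

lemma reciprocal_reflection:
  assumes "prime p" "0 < j" "j < p"
  shows "rat_cong (1 / of_nat (p - j)) (- (1 / of_nat j)) p"
proof -
  have "1 / of_nat (p - j) - (- (1 / of_nat j)) =
      of_nat p * (1 / of_nat (p - j) * (1 / of_nat j) :: rat)"
    using assms by (simp add: field_simps of_nat_diff)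
  moreover have "1 / of_nat (p - j) * (1 / of_nat j) \<in> Z_loc p"
    using assms by (intro Z_loc_mult Z_loc_inverse_of_nat) auto
  ultimately show ?thesis
    unfolding rat_cong_def by blast
qed

text \<open>Pairing \<open>1/j\<close> with \<open>1/(p - j)\<close> shows that the sum equals its own negative.\<close>

lemma harmonic_pred_prime:
  assumes "prime p" "p > 2"
  shows "rat_cong (harmonic (p - 1)) 0 p"
proof (rule rat_cong_uminus_self[OF assms])
  have "{0<..p - 1} = {1..p - 1}"
    by auto
  then have harmonic_eq: "harmonic (p - 1) = (\<Sum>j\<in>{1..p - 1}. 1 / of_nat j)"
    by (simp only: harmonic_def)
  have reversed: "harmonic (p - 1) = (\<Sum>j\<in>{1..p - 1}. 1 / of_nat (p - j))"
    unfolding harmonic_eq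
    by (subst sum.atLeastAtMost_rev) (use assms in \<open>auto intro!: sum.cong\<close>)
  have "rat_cong (\<Sum>j\<in>{1..p - 1}. 1 / of_nat (p - j))
      (\<Sum>j\<in>{1..p - 1}. - (1 / of_nat j)) p"
    using assms by (intro rat_cong_sum reciprocal_reflection) auto
  then show "rat_cong (harmonic (p - 1)) (- harmonic (p - 1)) p"
    by (simp only: sum_negf flip: harmonic_eq reversed)
qed

lemma harmonic_reflection:
  assumes "prime p" "p > 2" "k < p"
  shows "rat_cong (harmonic (p - 1 - k)) (harmonic k) p"
  using assms(3)
proof (induction k)
  case 0
  then show ?case
    using harmonic_pred_prime[OF assms(1,2)] by (simp add: harmonic_def)
next
  case (Suc k)
  have eq: "p - 1 - k = Suc (p - 1 - Suc k)" "Suc (p - 1 - Suc k) = p - Suc k"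
    using Suc.prems by auto
  have "harmonic (p - 1 - Suc k) = harmonic (p - 1 - k) - 1 / of_nat (p - Suc k)"
    using harmonic_Suc[of "p - 1 - Suc k"] unfolding eq by simp
  moreover have "rat_cong (harmonic (p - 1 - k) - 1 / of_nat (p - Suc k))
      (harmonic k - - (1 / of_nat (Suc k))) p"
    using Suc assms by (intro rat_cong_diff reciprocal_reflection) auto
  ultimately show ?case
    by (simp add: harmonic_Suc)
qed

text \<open>Reversing the order of summation turns the sum into its negative.\<close>

lemma antisymmetric_harmonic_sum:
  assumes p: "prime p" "p > 2"
    and f: "\<And>k. k < p \<Longrightarrow> f k \<in> Z_loc p"
    and refl: "\<And>k. k < p \<Longrightarrow> rat_cong (f (p - 1 - k)) (- f k) p"
  shows "rat_cong (\<Sum>k=0..p-1. f k * harmonic k) 0 p"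
proof (rule rat_cong_uminus_self[OF p])
  have "(\<Sum>k=0..p-1. f k * harmonic k) = (\<Sum>k=0..p-1. f (p - 1 - k) * harmonic (p - 1 - k))"
    by (subst sum.atLeastAtMost_rev) simp
  moreover have "rat_cong (\<Sum>k=0..p-1. f (p - 1 - k) * harmonic (p - 1 - k))
      (\<Sum>k=0..p-1. - f k * harmonic k) p"
    using p by (intro rat_cong_sum rat_cong_mult f refl harmonic_reflection harmonic_in_Z_loc) auto
  ultimately show "rat_cong (\<Sum>k=0..p-1. f k * harmonic k) (- (\<Sum>k=0..p-1. f k * harmonic k)) p"
    by (simp add: sum_negf)
qed

text \<open>
  The value of the sequence at \<open>-1\<close>, continued backwards, is \<open>c f\<^sub>0 - f\<^sub>1\<close>. Thus the two hypotheses say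
  that \<open>f\<^bsub>n-k\<^esub> \<equiv> -f\<^sub>k\<close> holds at \<open>k = 0\<close> and at \<open>k = -1\<close>. As functions of \<open>k\<close>, both sides solve the same
  recurrence, so the congruence spreads to all \<open>k\<close>.
\<close>

lemma palindromic_recurrence_reflection:
  assumes p: "prime p" and c: "c \<in> Z_loc p"
    and rec: "\<And>k. f (Suc (Suc k)) = c * f (Suc k) - f k"
    and start: "rat_cong (f n) (- f 0) p" "rat_cong (f (Suc n)) (- (c * f 0 - f 1)) p"
    and k: "k \<le> n"
  shows "rat_cong (f (n - k)) (- f k) p"
proof -
  have "k \<le> n \<longrightarrow> rat_cong (f (n - k)) (- f k) p"
  proof (induction k rule: induct_nat_012)
    case 0
    then show ?case
      using start by simp
  next
    case 1
    show ?case
    proof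
      assume "Suc 0 \<le> n"
      then have "f (n - Suc 0) = c * f n - f (Suc n)"
        using rec[of "n - Suc 0"] by simp
      moreover have "rat_cong (c * f n - f (Suc n)) (c * - f 0 - - (c * f 0 - f 1)) p"
        using p c start by (intro rat_cong_diff rat_cong_mult_left)
      ultimately show "rat_cong (f (n - Suc 0)) (- f (Suc 0)) p"
        by simp
    qed
  next
    case (ge2 k)
    show ?case
    proof
      assume k: "Suc (Suc k) \<le> n"
      then have "n - k = Suc (Suc (n - Suc (Suc k)))" "n - Suc k = Suc (n - Suc (Suc k))"
        by auto
      then have "f (n - Suc (Suc k)) = c * f (n - Suc k) - f (n - k)"
        using rec[of "n - Suc (Suc k)"] by simp
      moreover have "rat_cong (c * f (n - Suc k) - f (n - k)) (c * - f (Suc k) - - f k) p"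
        using p c ge2 k by (intro rat_cong_diff rat_cong_mult_left) auto
      ultimately show "rat_cong (f (n - Suc (Suc k))) (- f (Suc (Suc k))) p"
        by (simp add: rec)
    qed
  qed
  then show ?thesis
    using k by blast
qed

section \<open>The Lucas sequence at and after a prime\<close>

definition binomial_transform :: "(nat \<Rightarrow> int) \<Rightarrow> nat \<Rightarrow> int" where
  "binomial_transform f n = (\<Sum>k\<le>n. int (n choose k) * f k)"

lemma binomial_transform_Suc:
  "binomial_transform f (Suc n) = binomial_transform f n + binomial_transform (\<lambda>k. f (Suc k)) n"
proof -
  have "binomial_transform f (Suc n) =
      f 0 + (\<Sum>k\<le>n. int (n choose Suc k) * f (Suc k)) + (\<Sum>k\<le>n. int (n choose k) * f (Suc k))"
    unfolding binomial_transform_def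
    by (subst sum.atMost_Suc_shift) (simp add: algebra_simps sum.distrib)
  moreover have "f 0 + (\<Sum>k\<le>n. int (n choose Suc k) * f (Suc k)) =
      (\<Sum>k\<le>Suc n. int (n choose k) * f k)"
    by (subst sum.atMost_Suc_shift) simp
  ultimately show ?thesis
    by (simp add: binomial_transform_def)
qed

lemma binomial_transform_prime:
  assumes "prime p"
  shows "[binomial_transform f p = f 0 + f p] (mod int p)"
proof -
  have split: "{..p} = insert 0 (insert p {0<..<p})"
    by auto
  have "binomial_transform f p = f 0 + f p + (\<Sum>k\<in>{0<..<p}. int (p choose k) * f k)"
    unfolding binomial_transform_def split using assms by (auto simp: prime_gt_0_nat)
  moreover have "int p dvd (\<Sum>k\<in>{0<..<p}. int (p choose k) * f k)"
    by (intro dvd_sum dvd_mult2) (use assms in \<open>auto intro!: dvd_choose_prime\<close>)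
  ultimately show ?thesis
    by (simp add: cong_iff_dvd_diff)
qed

text \<open>
  The coefficients of \<open>(1 + \<surd>d)\<^sup>n\<close> at \<open>\<surd>d\<close> are the binomial transform of this sequence.
\<close>

definition odd_power :: "int \<Rightarrow> nat \<Rightarrow> int" where
  "odd_power d k = (if odd k then d ^ (k div 2) else 0)"

text \<open>
  This is Binet's formula: the characteristic roots are \<open>(1 \<plusminus> \<surd>d) / 2\<close> with \<open>d = 1 - 4 B\<close>.
\<close>

lemma lucas_u_binomial:
  "2 ^ n * lucas_u 1 B n = 2 * binomial_transform (odd_power (1 - 4 * B)) n"
proof (induction n rule: induct_nat_012)
  case 0
  then show ?case
    by (simp add: binomial_transform_def odd_power_def)
next
  case 1
  then show ?case
    by (simp add: binomial_transform_def odd_power_def)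
next
  case (ge2 n)
  let ?d = "1 - 4 * B" and ?T = binomial_transform
  have shift: "odd_power ?d (Suc (Suc k)) = ?d * odd_power ?d k" for k
    by (simp add: odd_power_def)
  have "?T (odd_power ?d) (Suc (Suc n)) =
      2 * ?T (odd_power ?d) (Suc n) + (?T (\<lambda>k. odd_power ?d (Suc (Suc k))) n - ?T (odd_power ?d) n)"
    by (simp add: binomial_transform_Suc)
  moreover have "?T (\<lambda>k. odd_power ?d (Suc (Suc k))) n = ?d * ?T (odd_power ?d) n"
    unfolding shift by (simp add: binomial_transform_def sum_distrib_left mult.left_commute)
  ultimately have "?T (odd_power ?d) (Suc (Suc n)) =
      2 * ?T (odd_power ?d) (Suc n) - 4 * B * ?T (odd_power ?d) n"
    by (simp add: algebra_simps)
  with ge2 show ?case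
    by (simp add: algebra_simps)
qed

lemma fermat_two:
  assumes "prime p" "p > 2"
  shows "[2 ^ (p - 1) = 1 :: int] (mod int p)"
proof -
  have "\<not> p dvd 2"
    using assms by (auto dest: dvd_imp_le)
  then have "[2 ^ (p - 1) = 1] (mod p)"
    using fermat_theorem assms by blast
  then show ?thesis
    using cong_int_iff[of "2 ^ (p - 1)" 1 p] by simp
qed

text \<open>
  Modulo \<open>p\<close> the middle binomial coefficients vanish, so \<open>(1 + \<surd>d)\<^sup>p \<equiv> 1 + d\<^bsup>(p-1)/2\<^esup> \<surd>d\<close>, and
  Euler's criterion evaluates the power of \<open>d = 1 - 4 B\<close>.
\<close>

lemma lucas_u_prime_cong:
  assumes p: "prime p" "p > 2"
  shows "[lucas_u 1 B p = Legendre (1 - 4 * B) p] (mod int p)"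
    and "[2 * lucas_u 1 B (Suc p) = 1 + Legendre (1 - 4 * B) p] (mod int p)"
proof -
  let ?d = "1 - 4 * B" and ?e = "Legendre (1 - 4 * B) (int p)"
  have odd: "odd p"
    using p prime_odd_nat by blast
  have half: "(p - 1) div 2 = p div 2"
    using odd by (elim oddE) simp
  have euler: "[odd_power ?d p = ?e] (mod int p)"
    using euler_criterion[OF p, of ?d] odd half by (simp add: odd_power_def cong_sym)
  have coprime_2: "coprime (2 :: int) (int p)"
    using odd by simp
  have "[2 * 2 ^ (p - 1) = 2 * 1 :: int] (mod int p)"
    using fermat_two[OF p] by (intro cong_mult cong_refl)
  then have fermat: "[2 ^ p = 2 :: int] (mod int p)"
    using p by (simp add: power_eq_if)
  have T: "[binomial_transform (odd_power ?d) p = ?e] (mod int p)"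
    using binomial_transform_prime[OF p(1), of "odd_power ?d"] euler cong_trans
    by (fastforce simp: odd_power_def)
  have "[2 * lucas_u 1 B p = 2 ^ p * lucas_u 1 B p] (mod int p)"
    using fermat by (intro cong_mult cong_refl) (rule cong_sym)
  also have "2 ^ p * lucas_u 1 B p = 2 * binomial_transform (odd_power ?d) p"
    by (rule lucas_u_binomial)
  also have "[\<dots> = 2 * ?e] (mod int p)"
    using T by (intro cong_mult cong_refl)
  finally show "[lucas_u 1 B p = ?e] (mod int p)"
    using coprime_2 by (simp add: cong_mult_lcancel)
  (* The exponent p + 1 of 1 + sqrt d is reached from p by one Pascal step, which adds the
     rational part of (1 + sqrt d)^p, congruent to 1. *)
  have "[binomial_transform (\<lambda>k. odd_power ?d (Suc k)) p = 1] (mod int p)"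
    using binomial_transform_prime[OF p(1), of "\<lambda>k. odd_power ?d (Suc k)"] odd
    by (simp add: odd_power_def)
  then have T': "[binomial_transform (odd_power ?d) (Suc p) = 1 + ?e] (mod int p)"
    unfolding binomial_transform_Suc using cong_add[OF T] by (subst add.commute[of 1])
  have "[2 * (2 * lucas_u 1 B (Suc p)) = 2 ^ p * (2 * lucas_u 1 B (Suc p))] (mod int p)"
    using fermat by (intro cong_mult cong_refl) (rule cong_sym)
  also have "2 ^ p * (2 * lucas_u 1 B (Suc p)) = 2 * binomial_transform (odd_power ?d) (Suc p)"
    using lucas_u_binomial[of "Suc p" B] by (simp only: power_Suc mult_ac)
  also have "[\<dots> = 2 * (1 + ?e)] (mod int p)"
    using T' by (intro cong_mult cong_refl)
  finally show "[2 * lucas_u 1 B (Suc p) = 1 + ?e] (mod int p)"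
    using coprime_2 by (subst (asm) cong_mult_lcancel) auto
qed

section \<open>Reciprocity for the discriminant\<close>

lemma Legendre_cases: "Legendre a q = 0 \<or> Legendre a q = 1 \<or> Legendre a q = -1"
  by (simp add: Legendre_def)

lemma Legendre_mod: "Legendre (a mod q) q = Legendre a q"
  by (simp add: Legendre_def QuadRes_def cong_def)

lemma Legendre_eqI:
  assumes "prime q" "q > 2" "[a ^ ((q - 1) div 2) = e] (mod int q)" "e = 0 \<or> e = 1 \<or> e = -1"
  shows "Legendre a (int q) = e"
proof -
  have "[Legendre a q = e] (mod int q)"
    using euler_criterion[OF assms(1,2)] assms(3) cong_trans by blast
  then have "int q dvd Legendre a q - e"
    by (simp add: cong_iff_dvd_diff)
  moreover have "\<bar>Legendre a q - e\<bar> < int q"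
    using Legendre_cases[of a q] assms(2,4) by auto
  ultimately have "Legendre a q - e = 0"
    using dvd_imp_le_int[of "Legendre a q - e" "int q"] by linarith
  then show ?thesis
    by simp
qed

lemma Legendre_mult:
  assumes "prime q" "q > 2"
  shows "Legendre (a * b) (int q) = Legendre a (int q) * Legendre b (int q)"
proof (rule Legendre_eqI[OF assms])
  show "[(a * b) ^ ((q - 1) div 2) = Legendre a (int q) * Legendre b (int q)] (mod int q)"
    using cong_mult[OF euler_criterion[OF assms, of a] euler_criterion[OF assms, of b]]
    by (simp add: power_mult_distrib cong_sym)
qed (use Legendre_cases[of a q] Legendre_cases[of b q] in auto)

lemma Legendre_minus_one:
  assumes "prime q" "q > 2"
  shows "Legendre (-1) (int q) = (-1) ^ ((q - 1) div 2)"
  by (rule Legendre_eqI[OF assms]) (auto simp: minus_one_power_iff)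

lemma jacobi_15: "jacobi a 15 = Legendre a 3 * Legendre a 5"
proof -
  have "prime_factorization (3 * 5 :: nat) = prime_factorization 3 + prime_factorization 5"
    by (intro prime_factorization_mult) auto
  then show ?thesis
    by (simp add: jacobi_def prime_factorization_prime)
qed

text \<open>
  Swapping \<open>3\<close> with \<open>p\<close> costs the sign \<open>(-1)\<^bsup>(p-1)/2\<^esup>\<close>, which is exactly the character of \<open>-1\<close> modulo \<open>p\<close>;
  swapping \<open>5\<close> with \<open>p\<close> costs none, as \<open>5\<close> is congruent to \<open>1\<close> modulo \<open>4\<close>.
\<close>

lemma Legendre_minus_15:
  assumes p: "prime p" "p > 5"
  shows "Legendre (-15) (int p) = jacobi (int p) 15"
proof -
  let ?s = "(-1 :: int) ^ ((p - 1) div 2)"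
  have "Legendre (-15) (int p) = Legendre (-1) p * (Legendre 3 p * Legendre 5 p)"
    using Legendre_mult[OF p(1), of "-1" "3 * 5"] Legendre_mult[OF p(1), of 3 5] p(2) by simp
  moreover have "Legendre (-1) p = ?s"
    using p by (intro Legendre_minus_one) auto
  moreover have "?s * Legendre 3 p = Legendre p 3"
    using Quadratic_Reciprocity[of p 3] p Legendre_cases[of p 3] Legendre_cases[of 3 p]
    by (auto simp: minus_one_power_iff split: if_splits)
  moreover have "Legendre p 5 * Legendre 5 p = 1"
    using Quadratic_Reciprocity[of p 5] p by (auto simp: power_mult minus_one_power_iff)
  then have "Legendre 5 p = Legendre p 5"
    using Legendre_cases[of p 5] by auto
  ultimately show ?thesis
    by (simp add: jacobi_15 flip: mult.assoc)
qed

lemma jacobi_15_values: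
  assumes p: "prime p" "p > 5"
  shows "jacobi (int p) 15 = (if p mod 15 \<in> {1, 2, 4, 8} then 1 else -1)"
    and "p mod 15 \<in> {1, 2, 4, 8} \<union> {7, 11, 13, 14}"
proof -
  have "\<not> 3 dvd p" "\<not> 5 dvd p"
    using p primes_dvd_imp_eq[of 3 p] primes_dvd_imp_eq[of 5 p] by auto
  then have "p mod 3 \<noteq> 0" "p mod 5 \<noteq> 0"
    by (simp_all add: dvd_eq_mod_eq_0)
  moreover define r where "r = p mod 15"
  moreover from this have mods: "p mod 3 = r mod 3" "p mod 5 = r mod 5"
    by (simp_all add: mod_mod_cancel)
  ultimately have r: "r mod 3 \<noteq> 0" "r mod 5 \<noteq> 0" "r < 15"
    by simp_all
  then have "r = 1 \<or> r = 2 \<or> r = 4 \<or> r = 7 \<or> r = 8 \<or> r = 11 \<or> r = 13 \<or> r = 14"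
    by presburger
  then have cases: "r \<in> {1, 2, 4, 8} \<and> (r mod 3, r mod 5) \<in> {(1, 1), (2, 2), (1, 4), (2, 3)} \<or>
      r \<in> {7, 11, 13, 14} \<and> (r mod 3, r mod 5) \<in> {(1, 2), (2, 1), (1, 3), (2, 4)}"
    by (elim disjE) simp_all
  then show "p mod 15 \<in> {1, 2, 4, 8} \<union> {7, 11, 13, 14}"
    unfolding r_def by blast
  have "jacobi (int p) 15 = Legendre (int (r mod 3)) 3 * Legendre (int (r mod 5)) 5"
    unfolding jacobi_15 mods[symmetric] by (simp add: Legendre_mod zmod_int)
  moreover have "Legendre 1 3 = 1" "Legendre 2 3 = -1"
    using Legendre_eqI[of 3 1 1] Legendre_eqI[of 3 2 "-1"] by (simp_all add: cong_def)
  moreover have "Legendre 1 5 = 1" "Legendre 2 5 = -1" "Legendre 3 5 = -1" "Legendre 4 5 = 1"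
    using Legendre_eqI[of 5 1 1] Legendre_eqI[of 5 2 "-1"] Legendre_eqI[of 5 3 "-1"]
      Legendre_eqI[of 5 4 1] by (simp_all add: cong_def)
  ultimately show "jacobi (int p) 15 = (if p mod 15 \<in> {1, 2, 4, 8} then 1 else -1)"
    unfolding r_def[symmetric] using cases by auto
qed

section \<open>The two harmonic sums\<close>

definition scaled_lucas :: "nat \<Rightarrow> rat" where
  "scaled_lucas k = of_int (lucas_u 1 4 k) / 2 ^ k"

lemma scaled_lucas_rec:
  "scaled_lucas (Suc (Suc k)) = 1 / 2 * scaled_lucas (Suc k) - scaled_lucas k"
  by (simp add: scaled_lucas_def field_simps)

lemma coprime_two_power: "prime p \<Longrightarrow> p > 2 \<Longrightarrow> coprime (2 ^ k) (int p)"
  using prime_odd_nat[of p] by simp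

lemma scaled_lucas_in_Z_loc: "prime p \<Longrightarrow> p > 2 \<Longrightarrow> scaled_lucas k \<in> Z_loc p"
  using Z_loc_fraction[of p "2 ^ k" "lucas_u 1 4 k"] coprime_two_power[of p k]
  by (simp add: scaled_lucas_def)

lemma scaled_lucas_prime:
  assumes p: "prime p" "p > 2"
  shows "rat_cong (scaled_lucas p) (of_int (Legendre (-15) p) / 2) p"
    and "rat_cong (scaled_lucas (Suc p)) (of_int (1 + Legendre (-15) p) / 8) p"
proof -
  let ?e = "Legendre (-15) (int p)"
  have fermat: "[?e * 2 ^ (p - 1) = ?e * 1] (mod int p)"
      "[(1 + ?e) * 2 ^ (p - 1) = (1 + ?e) * 1] (mod int p)"
    using fermat_two[OF p] by (auto intro!: cong_mult simp del: mult.right_neutral)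
  have pow: "(2 :: rat) ^ p = 2 * 2 ^ (p - 1)"
    using p by (simp add: power_eq_if)
  show "rat_cong (scaled_lucas p) (of_int ?e / 2) p"
  proof (rule rat_cong_fraction[OF p(1) coprime_two_power[OF p]])
    show "int p dvd lucas_u 1 4 p - ?e * 2 ^ (p - 1)"
      using lucas_u_prime_cong(1)[OF p, of 4] fermat(1) cong_trans cong_sym
      by (fastforce simp flip: cong_iff_dvd_diff)
    show "scaled_lucas p - of_int ?e / 2 = of_int (lucas_u 1 4 p - ?e * 2 ^ (p - 1)) / of_int (2 ^ p)"
      by (simp add: scaled_lucas_def pow field_simps)
  qed
  show "rat_cong (scaled_lucas (Suc p)) (of_int (1 + ?e) / 8) p"
  proof (rule rat_cong_fraction[OF p(1) coprime_two_power[OF p]])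
    show "int p dvd 2 * lucas_u 1 4 (Suc p) - (1 + ?e) * 2 ^ (p - 1)"
      using lucas_u_prime_cong(2)[OF p, of 4] fermat(2) cong_trans cong_sym
      by (fastforce simp flip: cong_iff_dvd_diff)
    show "scaled_lucas (Suc p) - of_int (1 + ?e) / 8 =
        of_int (2 * lucas_u 1 4 (Suc p) - (1 + ?e) * 2 ^ (p - 1)) / of_int (2 ^ (p + 2))"
      by (simp add: scaled_lucas_def pow field_simps del: lucas_u.simps)
  qed
qed

text \<open>
  The characteristic root \<open>w\<close> satisfies \<open>w\<^bsup>p-1\<^esup> = 1\<close> modulo \<open>p\<close>, so the index \<open>p - 1 - k\<close> can be replaced by
  \<open>-k\<close>, and \<open>U\<close> is odd.
\<close>

lemma scaled_lucas_reflection_residue: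
  assumes p: "prime p" "p > 2" and e: "Legendre (-15) p = 1" and k: "k < p"
  shows "rat_cong (scaled_lucas (p - 1 - k)) (- scaled_lucas k) p"
proof (rule palindromic_recurrence_reflection[where f = scaled_lucas and c = "1 / 2",
      OF p(1) _ scaled_lucas_rec])
  show half: "1 / 2 \<in> Z_loc p"
    using Z_loc_inverse_of_nat[of p 2] p by simp
  have Up: "rat_cong (scaled_lucas p) (1 / 2) p" "rat_cong (scaled_lucas (Suc p)) (1 / 4) p"
    using scaled_lucas_prime[OF p] e by auto
  have "scaled_lucas (p - 1) = 1 / 2 * scaled_lucas p - scaled_lucas (Suc p)"
    using scaled_lucas_rec[of "p - 1"] p by simp
  moreover have "rat_cong (1 / 2 * scaled_lucas p - scaled_lucas (Suc p)) (1 / 2 * (1 / 2) - 1 / 4) p"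
    using p half Up by (intro rat_cong_diff rat_cong_mult_left)
  ultimately show "rat_cong (scaled_lucas (p - 1)) (- scaled_lucas 0) p"
    by (simp add: scaled_lucas_def)
  show "rat_cong (scaled_lucas (Suc (p - 1))) (- (1 / 2 * scaled_lucas 0 - scaled_lucas 1)) p"
    using Up(1) p by (simp add: scaled_lucas_def)
qed (use k in auto)

text \<open>
  Now \<open>w\<^bsup>p+1\<^esup> = 1\<close> modulo \<open>p\<close>, so the index \<open>p - k\<close> can be replaced by \<open>-(k + 1)\<close>.
\<close>

lemma scaled_lucas_reflection_nonresidue:
  assumes p: "prime p" "p > 2" and e: "Legendre (-15) p = -1" and k: "k < p"
  shows "rat_cong (scaled_lucas (Suc (p - 1 - k))) (- scaled_lucas (Suc k)) p"
proof (rule palindromic_recurrence_reflection[where f = "\<lambda>k. scaled_lucas (Suc k)" and c = "1 / 2",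
      OF p(1) _ scaled_lucas_rec])
  show "1 / 2 \<in> Z_loc p"
    using Z_loc_inverse_of_nat[of p 2] p by simp
  have Up: "rat_cong (scaled_lucas p) (- (1 / 2)) p" "rat_cong (scaled_lucas (Suc p)) 0 p"
    using scaled_lucas_prime[OF p] e by auto
  show "rat_cong (scaled_lucas (Suc (p - 1))) (- scaled_lucas (Suc 0)) p"
    using Up(1) p by (simp add: scaled_lucas_def)
  show "rat_cong (scaled_lucas (Suc (Suc (p - 1))))
      (- (1 / 2 * scaled_lucas (Suc 0) - scaled_lucas (Suc 1))) p"
    using Up(2) p by (simp add: scaled_lucas_def del: lucas_u.simps(3)) (simp add: numeral_2_eq_2)
qed (use k in auto)

theorem theorem1p3:
  fixes p :: nat
  assumes "prime p" and "p > 5"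
  shows "(jacobi (int p) 15 = 1 \<longleftrightarrow> p mod 15 \<in> {1, 2, 4, 8})
    \<and> (jacobi (int p) 15 = 1 \<longrightarrow>
        rat_cong (\<Sum>k=0..p-1. of_int (lucas_u 1 4 k) / 2 ^ k * harmonic k) 0 p)
    \<and> (jacobi (int p) 15 = -1 \<longleftrightarrow> p mod 15 \<in> {7, 11, 13, 14})
    \<and> (jacobi (int p) 15 = -1 \<longrightarrow>
        rat_cong (\<Sum>k=0..p-1. of_int (lucas_u 1 4 (k + 1)) / 2 ^ k * harmonic k) 0 p)"
proof (intro conjI impI)
  have p2: "p > 2"
    using assms(2) by simp
  show "jacobi (int p) 15 = 1 \<longleftrightarrow> p mod 15 \<in> {1, 2, 4, 8}"
    using jacobi_15_values[OF assms] by simp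
  show "jacobi (int p) 15 = -1 \<longleftrightarrow> p mod 15 \<in> {7, 11, 13, 14}"
    using jacobi_15_values[OF assms] by auto
  show "rat_cong (\<Sum>k=0..p-1. of_int (lucas_u 1 4 k) / 2 ^ k * harmonic k) 0 p"
    if "jacobi (int p) 15 = 1"
    using antisymmetric_harmonic_sum[OF assms(1) p2 scaled_lucas_in_Z_loc[OF assms(1) p2]]
      scaled_lucas_reflection_residue[OF assms(1) p2] that
    by (simp add: scaled_lucas_def Legendre_minus_15[OF assms])
  show "rat_cong (\<Sum>k=0..p-1. of_int (lucas_u 1 4 (k + 1)) / 2 ^ k * harmonic k) 0 p"
    if "jacobi (int p) 15 = -1"
  proof -
    have "rat_cong (\<Sum>k=0..p-1. scaled_lucas (Suc k) * harmonic k) 0 p"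
      using assms(1) p2 that
      by (intro antisymmetric_harmonic_sum scaled_lucas_in_Z_loc scaled_lucas_reflection_nonresidue)
         (auto simp: Legendre_minus_15[OF assms])
    \<comment> \<open>The factor \<open>2\<close> turns the weight \<open>2\<^bsup>-(k+1)\<^esup>\<close> of \<open>U\<^sub>k\<^sub>+\<^sub>1\<close> into \<open>2\<^sup>-\<^sup>k\<close>.\<close>
    then have "rat_cong (of_int 2 * (\<Sum>k=0..p-1. scaled_lucas (Suc k) * harmonic k)) (of_int 2 * 0) p"
      by (intro rat_cong_mult_left Z_loc_of_int assms(1))
    moreover have "of_int 2 * (\<Sum>k=0..p-1. scaled_lucas (Suc k) * harmonic k) =
        (\<Sum>k=0..p-1. of_int (lucas_u 1 4 (k + 1)) / 2 ^ k * harmonic k)"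
      by (simp add: sum_distrib_left scaled_lucas_def)
    ultimately show ?thesis
      by simp
  qed
qed

end
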